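(* Let $\mathcal{H}$ be a reproducing kernel Hilbert space of analytic functions over a domain $\Omega\subset\mathbb{C}^n$, with reproducing kernel at the point $\lambda\in\Omega$ given by $K_\lambda$, and let $\{\lambda_n\}$ be a sequence in $\Omega$. Then $\{\lambda_n\}$ is an $EIS_{\mathcal{H}}$ sequence if and only if $\{\lambda_n\}$ is an $AIS_{\mathcal{H}}$ sequence.
   Context: The reproducing kernel satisfies $f(\lambda)=\langle f,K_\lambda\rangle_{\mathcal{H}}$ for all $f\in\mathcal{H}$, so $K_\lambda(\lambda)=\|K_\lambda\|_{\mathcal{H}}^2$. It is understood that $K_{\lambda_n}(\lambda_n)\neq0$ for all $n$, so that the expressions below make sense. For $a=\{a_n\}\in\ell^2$ put $\|a\|_{N,\ell^2}=\left(\sum_{j\ge N}|a_j|^2\right)^{1/2}$. $\{\lambda_n\}\subset\Omega$ is an eventual $1$-interpolating sequence for $\mathcal{H}$ (denoted $EIS_{\mathcal{H}}$) if for every $\varepsilon>0$ there exists $N$ such that for each $a=\{a_n\}\in\ell^2$ there exists $f_{N,a}\in\mathcal{H}$ with $$f_{N,a}(\lambda_n)K_{\lambda_n}(\lambda_n)^{-1/2}=a_n\ \text{ for all } n\ge N\quad\text{and}\quad\|f_{N,a}\|_{\mathcal{H}}\le(1+\varepsilon)\|a\|_{N,\ell^2}.$$ $\{\lambda_n\}\subset\Omega$ is a strong asymptotic interpolating sequence for $\mathcal{H}$ (denoted $AIS_{\mathcal{H}}$) if for every $\varepsilon>0$ there exists $N$ such that for all $a=\{a_n\}\in\ell^2$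 with $\|a\|_{N,\ell^2}\ne0$ there exists $G_{N,a}\in\mathcal{H}$ with $\|G_{N,a}\|_{\mathcal{H}}\le\|a\|_{N,\ell^2}$ and $$\|\{G_{N,a}(\lambda_n)K_{\lambda_n}(\lambda_n)^{-1/2}-a_n\}\|_{N,\ell^2}<\varepsilon\|a\|_{N,\ell^2}.$$ *)

theory Defs
  imports "HOL-Analysis.Analysis"
begin

text \<open>
  There is no library notion of analyticity in several complex variables. The sum below runs over
  all multi-indices and converges unconditionally, as is standard for multiple power series.
\<close>

definition analytic_several :: "(complex ^ 'n) set \<Rightarrow> (complex ^ 'n \<Rightarrow> complex) \<Rightarrow> bool" where
  "analytic_several \<Omega> f \<longleftrightarrow>
     (\<forall>z\<in>\<Omega>. \<exists>r>0. \<exists>c :: ('n \<Rightarrow> nat) \<Rightarrow> complex. \<forall>w\<in>ball z r.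
        ((\<lambda>\<alpha>. c \<alpha> * (\<Prod>i\<in>UNIV. (w $ i - z $ i) ^ \<alpha> i)) has_sum f w) UNIV)"

definition hnorm :: "('f \<Rightarrow> 'f \<Rightarrow> complex) \<Rightarrow> 'f \<Rightarrow> real" where
  "hnorm ip f = sqrt (Re (ip f f))"

text \<open>
  A complex Hilbert space whose elements are functions on the set \<open>S\<close>. A function on \<open>S\<close> is
  represented by its extension by \<open>0\<close> to the whole type, so that equality of functions is equality
  on \<open>S\<close>. The inner product \<open>ip\<close> is linear in its first argument, and its values off the carrier
  \<open>H\<close> are irrelevant.
\<close>

locale function_hilbert_space =
  fixes S :: "'p set"
    and H :: "('p \<Rightarrow> complex) set"
    and ip :: "('p \<Rightarrow> complex) \<Rightarrow> ('p \<Rightarrow> complex) \<Rightarrow> complex"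
  assumes zero_outside: "f \<in> H \<Longrightarrow> z \<notin> S \<Longrightarrow> f z = 0"
    and zero_mem: "(\<lambda>_. 0) \<in> H"
    and add_mem: "f \<in> H \<Longrightarrow> g \<in> H \<Longrightarrow> (\<lambda>z. f z + g z) \<in> H"
    and scale_mem: "f \<in> H \<Longrightarrow> (\<lambda>z. c * f z) \<in> H"
    and ip_add_left: "f \<in> H \<Longrightarrow> g \<in> H \<Longrightarrow> h \<in> H \<Longrightarrow> ip (\<lambda>z. f z + g z) h = ip f h + ip g h"
    and ip_scale_left: "f \<in> H \<Longrightarrow> g \<in> H \<Longrightarrow> ip (\<lambda>z. c * f z) g = c * ip f g"
    and ip_commute: "f \<in> H \<Longrightarrow> g \<in> H \<Longrightarrow> ip g f = cnj (ip f g)"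
    and ip_nonneg: "f \<in> H \<Longrightarrow> 0 \<le> Re (ip f f)"
    and ip_eq_0: "f \<in> H \<Longrightarrow> ip f f = 0 \<Longrightarrow> f = (\<lambda>_. 0)"
    and complete: "(\<And>k. X k \<in> H) \<Longrightarrow>
        (\<forall>e>0. \<exists>M. \<forall>k\<ge>M. \<forall>l\<ge>M. hnorm ip (\<lambda>z. X k z - X l z) < e) \<Longrightarrow>
        \<exists>f\<in>H. (\<lambda>k. hnorm ip (\<lambda>z. X k z - f z)) \<longlonglongrightarrow> 0"

locale rkhs = function_hilbert_space S H ip
  for S :: "'p set"
    and H :: "('p \<Rightarrow> complex) set"
    and ip :: "('p \<Rightarrow> complex) \<Rightarrow> ('p \<Rightarrow> complex) \<Rightarrow> complex" +
  fixes K :: "'p \<Rightarrow> 'p \<Rightarrow> complex"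
  assumes kernel_mem: "z \<in> S \<Longrightarrow> K z \<in> H"
    and reproducing: "z \<in> S \<Longrightarrow> f \<in> H \<Longrightarrow> f z = ip f (K z)"

definition l2 :: "(nat \<Rightarrow> complex) \<Rightarrow> bool" where
  "l2 a \<longleftrightarrow> summable (\<lambda>j. (cmod (a j))\<^sup>2)"

text \<open>Meaningful only for \<open>l2\<close> sequences.\<close>

definition l2_tail_norm :: "nat \<Rightarrow> (nat \<Rightarrow> complex) \<Rightarrow> real" where
  "l2_tail_norm N a = sqrt (\<Sum>j. (cmod (a (j + N)))\<^sup>2)"

definition EIS ::
  "('p \<Rightarrow> complex) set \<Rightarrow> (('p \<Rightarrow> complex) \<Rightarrow> ('p \<Rightarrow> complex) \<Rightarrow> complex) \<Rightarrow>
   ('p \<Rightarrow> 'p \<Rightarrow> complex) \<Rightarrow> (nat \<Rightarrow> 'p) \<Rightarrow> bool" where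
  "EIS H ip K lam \<longleftrightarrow>
     (\<forall>\<epsilon>>0. \<exists>N. \<forall>a. l2 a \<longrightarrow>
        (\<exists>f\<in>H. (\<forall>n\<ge>N. f (lam n) * K (lam n) (lam n) powr (- 1 / 2) = a n) \<and>
               hnorm ip f \<le> (1 + \<epsilon>) * l2_tail_norm N a))"

text \<open>
  Since \<open>l2_tail_norm\<close> is real-valued, the finiteness implicit in the bound on the error sequence
  is the explicit conjunct \<open>l2\<close>.
\<close>

definition AIS ::
  "('p \<Rightarrow> complex) set \<Rightarrow> (('p \<Rightarrow> complex) \<Rightarrow> ('p \<Rightarrow> complex) \<Rightarrow> complex) \<Rightarrow>
   ('p \<Rightarrow> 'p \<Rightarrow> complex) \<Rightarrow> (nat \<Rightarrow> 'p) \<Rightarrow> bool" where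
  "AIS H ip K lam \<longleftrightarrow>
     (\<forall>\<epsilon>>0. \<exists>N. \<forall>a. l2 a \<and> l2_tail_norm N a \<noteq> 0 \<longrightarrow>
        (\<exists>G\<in>H. hnorm ip G \<le> l2_tail_norm N a \<and>
               l2 (\<lambda>n. G (lam n) * K (lam n) (lam n) powr (- 1 / 2) - a n) \<and>
               l2_tail_norm N (\<lambda>n. G (lam n) * K (lam n) (lam n) powr (- 1 / 2) - a n)
                 < \<epsilon> * l2_tail_norm N a))"

end

theory Submission
  imports Defs
begin

text \<open>
  Write \<open>T f\<close> for the sequence of normalized values \<open>f(\<lambda>\<^sub>n) w\<^sub>n\<close>, where \<open>w\<^sub>n\<close> is the number
  \<open>K(\<lambda>\<^sub>n)(\<lambda>\<^sub>n)\<close> raised to the power \<open>-1/2\<close>; all norms of sequences below are norms of tails.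
  Both notions measure how well \<open>T\<close> can be inverted on tails of sequences; one asks for exact inversion at a cost \<open>1 + \<epsilon>\<close> in the norm, the other
  for inversion up to an error \<open>\<epsilon>\<close> at no cost in the norm, and either defect can be traded for
  the other.

  An exact interpolant of norm at most \<open>(1 + \<epsilon>) \<parallel>a\<parallel>\<close> becomes, after division by \<open>1 + \<epsilon>\<close>, an
  admissible approximate one: the error \<open>T G - a\<close> is \<open>- \<epsilon> / (1 + \<epsilon>) a\<close> on the tail.

  Conversely, suppose that each \<open>a\<close> has an approximate interpolant \<open>G\<close> with \<open>\<parallel>G\<parallel> \<le> \<parallel>a\<parallel>\<close> and
  \<open>\<parallel>a - T G\<parallel> \<le> d \<parallel>a\<parallel>\<close>, where \<open>d < 1\<close> and one \<open>N\<close> serves all \<open>a\<close>. As the residual \<open>a - T G\<close>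
  is again a legitimate target, it can be approximated in turn, and the residuals decay
  like \<open>d\<^sup>k\<close> (this is the iteration in the proof of the open mapping theorem). The corrections add
  up to an element of the Hilbert space of norm at most \<open>\<parallel>a\<parallel> / (1 - d)\<close>, which interpolates \<open>a\<close>
  exactly because norm convergence implies pointwise convergence in a reproducing kernel space.
  The choice \<open>d = \<epsilon> / (1 + \<epsilon>)\<close> makes the constant equal to \<open>1 + \<epsilon>\<close>. The two halves
  of this argument are the lemmas \<open>absolutely_convergent_series\<close> and
  \<open>exact_from_approximate_interpolation\<close>.
\<close>

section \<open>The norm of a Hilbert space of functions\<close>

context function_hilbert_space
begin

lemma diff_mem:
  assumes "f \<in> H" "g \<in> H"
  shows "(\<lambda>z. f z - g z) \<in> H"
  using add_mem[OF assms(1) scale_mem[OF assms(2), of "-1"]] by simp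

lemma sum_mem:
  assumes "\<And>i. G i \<in> H"
  shows "(\<lambda>z. \<Sum>i<k::nat. G i z) \<in> H"
  by (induction k) (simp_all add: zero_mem add_mem assms)

lemma ip_add_right:
  assumes "f \<in> H" "g \<in> H" "h \<in> H"
  shows "ip h (\<lambda>z. f z + g z) = ip h f + ip h g"
  unfolding ip_commute[OF add_mem[OF assms(1,2)] assms(3)] ip_commute[OF assms(1,3)]
    ip_commute[OF assms(2,3)] ip_add_left[OF assms] by (rule complex_cnj_add)

lemma ip_scale_right:
  assumes "f \<in> H" "g \<in> H"
  shows "ip g (\<lambda>z. c * f z) = cnj c * ip g f"
  unfolding ip_commute[OF scale_mem[OF assms(1)] assms(2)] ip_commute[OF assms]
    ip_scale_left[OF assms] by (rule complex_cnj_mult)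

lemma hnorm_nonneg: "f \<in> H \<Longrightarrow> 0 \<le> hnorm ip f"
  by (simp add: hnorm_def ip_nonneg)

lemma hnorm_power2: "f \<in> H \<Longrightarrow> (hnorm ip f)\<^sup>2 = Re (ip f f)"
  by (simp add: hnorm_def ip_nonneg)

lemma hnorm_zero: "hnorm ip (\<lambda>_. 0) = 0"
  using ip_scale_left[OF zero_mem zero_mem, of 0] by (simp add: hnorm_def)

lemma hnorm_scale:
  assumes "f \<in> H"
  shows "hnorm ip (\<lambda>z. c * f z) = cmod c * hnorm ip f"
proof -
  have "ip (\<lambda>z. c * f z) (\<lambda>z. c * f z) = of_real ((cmod c)\<^sup>2) * ip f f"
    using assms
    by (simp add: ip_scale_left ip_scale_right scale_mem complex_norm_square mult.assoc
             del: of_real_power)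
  then show ?thesis
    by (simp add: hnorm_def real_sqrt_mult)
qed

lemma hnorm_add_power2:
  assumes "f \<in> H" "g \<in> H"
  shows "(hnorm ip (\<lambda>z. f z + g z))\<^sup>2 = (hnorm ip f)\<^sup>2 + 2 * Re (ip f g) + (hnorm ip g)\<^sup>2"
proof -
  have "Re (ip g f) = Re (ip f g)"
    using ip_commute[OF assms] by simp
  then show ?thesis
    using assms by (simp add: hnorm_power2 add_mem ip_add_left ip_add_right)
qed

lemma Cauchy_Schwarz:
  assumes "f \<in> H" "g \<in> H"
  shows "cmod (ip f g) \<le> hnorm ip f * hnorm ip g"
proof (cases "hnorm ip g = 0")
  case True
  have "ip g g = cnj (ip g g)"
    using ip_commute assms(2) by blast
  then have "Im (ip g g) = 0"
    by (metis Reals_cnj_iff complex_is_Real_iff)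
  moreover have "Re (ip g g) = 0"
    using True hnorm_power2[OF assms(2)] by simp
  ultimately have "g = (\<lambda>_. 0)"
    using ip_eq_0[OF assms(2)] by (simp add: complex_eq_iff)
  then have "ip f g = 0"
    using ip_scale_right[OF zero_mem assms(1), of 0] by simp
  then show ?thesis
    using True by simp
next
  case False
  define B where "B = (hnorm ip g)\<^sup>2"
  have B: "B > 0"
    using False by (simp add: B_def)
  \<comment> \<open>With this \<open>c\<close>, the vector \<open>f + c g\<close> is the component of \<open>f\<close> orthogonal to \<open>g\<close>.\<close>
  define c where "c = - (ip f g / of_real B)"
  have cg: "(\<lambda>z. c * g z) \<in> H"
    using assms(2) by (rule scale_mem)
  have "cnj c * ip f g = - (cnj (ip f g) * ip f g / of_real B)"
    by (simp add: c_def)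
  also have "\<dots> = of_real (- ((cmod (ip f g))\<^sup>2 / B))"
    unfolding of_real_minus of_real_divide complex_norm_square by (simp only: mult.commute)
  finally have cross: "Re (ip f (\<lambda>z. c * g z)) = - ((cmod (ip f g))\<^sup>2 / B)"
    unfolding ip_scale_right[OF assms(2,1)] by (simp only: Re_complex_of_real)
  have "cmod c = cmod (ip f g) / B"
    using B by (simp add: c_def norm_divide)
  then have "(hnorm ip (\<lambda>z. c * g z))\<^sup>2 = (cmod (ip f g) / B)\<^sup>2 * B"
    by (simp only: hnorm_scale[OF assms(2)] power_mult_distrib B_def)
  also have "\<dots> = (cmod (ip f g))\<^sup>2 / B"
    using B by (simp add: power2_eq_square)
  finally have square: "(hnorm ip (\<lambda>z. c * g z))\<^sup>2 = (cmod (ip f g))\<^sup>2 / B" .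
  have "0 \<le> (hnorm ip (\<lambda>z. f z + c * g z))\<^sup>2"
    by simp
  also have "\<dots> = (hnorm ip f)\<^sup>2 - (cmod (ip f g))\<^sup>2 / B"
    unfolding hnorm_add_power2[OF assms(1) cg] cross square by linarith
  finally have "(cmod (ip f g))\<^sup>2 \<le> (hnorm ip f)\<^sup>2 * B"
    using B by (simp add: field_simps)
  then have "(cmod (ip f g))\<^sup>2 \<le> (hnorm ip f * hnorm ip g)\<^sup>2"
    by (simp add: B_def power_mult_distrib)
  then show ?thesis
    by (rule power2_le_imp_le) (simp add: hnorm_nonneg assms)
qed

lemma hnorm_triangle:
  assumes "f \<in> H" "g \<in> H"
  shows "hnorm ip (\<lambda>z. f z + g z) \<le> hnorm ip f + hnorm ip g"
proof (rule power2_le_imp_le)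
  have "Re (ip f g) \<le> hnorm ip f * hnorm ip g"
    using Cauchy_Schwarz[OF assms] complex_Re_le_cmod order_trans by blast
  then show "(hnorm ip (\<lambda>z. f z + g z))\<^sup>2 \<le> (hnorm ip f + hnorm ip g)\<^sup>2"
    by (simp add: hnorm_add_power2[OF assms] power2_sum)
qed (simp add: hnorm_nonneg assms)

lemma hnorm_diff_commute:
  assumes "f \<in> H" "g \<in> H"
  shows "hnorm ip (\<lambda>z. f z - g z) = hnorm ip (\<lambda>z. g z - f z)"
proof -
  have "hnorm ip (\<lambda>z. -1 * (g z - f z)) = hnorm ip (\<lambda>z. g z - f z)"
    unfolding hnorm_scale[OF diff_mem[OF assms(2,1)]] by simp
  then show ?thesis
    by (simp only: mult_minus1 minus_diff_eq)
qed

lemma hnorm_diff_partial_sums: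
  fixes k l :: nat
  assumes G: "\<And>i. G i \<in> H" and r: "\<And>i. hnorm ip (G i) \<le> r i" and "k \<le> l"
  shows "hnorm ip (\<lambda>z. (\<Sum>i<l. G i z) - (\<Sum>i<k. G i z)) \<le> (\<Sum>i=k..<l. r i)"
  using \<open>k \<le> l\<close>
proof (induction l rule: dec_induct)
  case base
  then show ?case by (simp add: hnorm_zero)
next
  case (step l)
  let ?D = "\<lambda>z. (\<Sum>i<l. G i z) - (\<Sum>i<k. G i z)"
  have "?D \<in> H"
    using G by (intro diff_mem sum_mem)
  then have "hnorm ip (\<lambda>z. ?D z + G l z) \<le> hnorm ip ?D + hnorm ip (G l)"
    by (rule hnorm_triangle) (rule G)
  also have "\<dots> \<le> (\<Sum>i=k..<l. r i) + r l"
    using step.IH r[of l] by simp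
  also have "\<dots> = (\<Sum>i=k..<Suc l. r i)"
    using step.hyps by simp
  finally show ?case
    by (simp add: algebra_simps)
qed

end

section \<open>Absolutely convergent series in a reproducing kernel space\<close>

context rkhs
begin

lemma norm_eval_le:
  assumes "z \<in> S" "f \<in> H"
  shows "cmod (f z) \<le> hnorm ip f * hnorm ip (K z)"
  using Cauchy_Schwarz[OF assms(2) kernel_mem[OF assms(1)]] reproducing[OF assms] by simp

text \<open>
  Completeness provides a norm limit \<open>f\<close> of the partial sums. Since evaluation at a point is
  bounded, \<open>f\<close> is also the pointwise sum of the series.
\<close>

lemma absolutely_convergent_series:
  assumes G: "\<And>k. G k \<in> H" and r: "\<And>k. hnorm ip (G k) \<le> r k" and "summable r"
  shows "\<exists>f\<in>H. hnorm ip f \<le> suminf r \<and> (\<forall>z\<in>S. (\<lambda>k. G k z) sums f z)"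
proof -
  define P where "P k = (\<lambda>z. \<Sum>i<k. G i z)" for k
  have P: "P k \<in> H" for k
    unfolding P_def using G by (rule sum_mem)
  have r_nonneg: "0 \<le> r k" for k
    using hnorm_nonneg[OF G] r order_trans by blast
  have increments: "hnorm ip (\<lambda>z. P l z - P k z) \<le> (\<Sum>i=k..<l. r i)" if "k \<le> l" for k l
    unfolding P_def using G r that by (rule hnorm_diff_partial_sums)
  have "\<forall>e>0. \<exists>M. \<forall>k\<ge>M. \<forall>l\<ge>M. hnorm ip (\<lambda>z. P k z - P l z) < e"
  proof (intro allI impI)
    fix e :: real assume "e > 0"
    then obtain M where M: "\<And>m n. m \<ge> M \<Longrightarrow> norm (\<Sum>i=m..<n. r i) < e"
      using \<open>summable r\<close> unfolding summable_Cauchy by blast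
    have ordered: "hnorm ip (\<lambda>z. P l z - P k z) < e" if "M \<le> k" "k \<le> l" for k l
      using increments[OF that(2)] M[OF that(1), of l] by simp
    have "hnorm ip (\<lambda>z. P k z - P l z) < e" if "k \<ge> M" "l \<ge> M" for k l
      using ordered[of k l] ordered[of l k] that hnorm_diff_commute[OF P P, of k l]
      by (cases "k \<le> l") auto
    then show "\<exists>M. \<forall>k\<ge>M. \<forall>l\<ge>M. hnorm ip (\<lambda>z. P k z - P l z) < e"
      by blast
  qed
  from complete[OF P this] obtain f
    where f: "f \<in> H" and lim: "(\<lambda>k. hnorm ip (\<lambda>z. P k z - f z)) \<longlonglongrightarrow> 0"
    by blast
  have "hnorm ip f \<le> suminf r + hnorm ip (\<lambda>z. P k z - f z)" for k
  proof -
    have "hnorm ip f \<le> hnorm ip (P k) + hnorm ip (\<lambda>z. f z - P k z)"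
      using hnorm_triangle[OF P diff_mem[OF f P], of k k] by simp
    moreover have "hnorm ip (P k) \<le> (\<Sum>i<k. r i)"
      using increments[of 0 k] by (simp add: P_def atLeast0LessThan)
    moreover have "(\<Sum>i<k. r i) \<le> suminf r"
      using \<open>summable r\<close> r_nonneg by (intro sum_le_suminf) auto
    ultimately show ?thesis
      using hnorm_diff_commute[OF f P, of k] by simp
  qed
  then have "hnorm ip f \<le> suminf r"
    using tendsto_add[OF tendsto_const[of "suminf r"] lim]
    by (intro LIMSEQ_le_const[where a = "hnorm ip f"]) auto
  moreover have "(\<lambda>k. G k z) sums f z" if "z \<in> S" for z
  proof -
    have "(\<lambda>k. hnorm ip (\<lambda>z. P k z - f z) * hnorm ip (K z)) \<longlonglongrightarrow> 0"
      using tendsto_mult_right[OF lim] by simp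
    then have "(\<lambda>k. P k z - f z) \<longlonglongrightarrow> 0"
      by (rule Lim_null_comparison[rotated])
        (intro always_eventually allI norm_eval_le[OF that diff_mem[OF P f]])
    then show ?thesis
      unfolding sums_def P_def by (simp add: LIM_zero_iff)
  qed
  ultimately show ?thesis
    using f by blast
qed

end

section \<open>Tails of square summable sequences\<close>

lemma l2_shift: "l2 a \<longleftrightarrow> summable (\<lambda>j. (cmod (a (j + N)))\<^sup>2)"
  unfolding l2_def by (rule summable_iff_shift[symmetric])

lemma l2_tail_norm_nonneg: "l2 a \<Longrightarrow> 0 \<le> l2_tail_norm N a"
  unfolding l2_tail_norm_def by (simp add: l2_shift[of a N] suminf_nonneg)

lemma norm_le_l2_tail_norm:
  assumes "l2 a" "N \<le> n"
  shows "cmod (a n) \<le> l2_tail_norm N a"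
proof -
  have "(cmod (a (n - N + N)))\<^sup>2 \<le> (\<Sum>j. (cmod (a (j + N)))\<^sup>2)"
    using sum_le_suminf[of "\<lambda>j. (cmod (a (j + N)))\<^sup>2" "{n - N}"] assms(1)
    by (simp add: l2_shift[of a N])
  then show ?thesis
    using assms(2) by (simp add: l2_tail_norm_def real_le_rsqrt)
qed

lemma
  assumes "l2 a" and "\<And>n. n \<ge> N \<Longrightarrow> b n = c * a n"
  shows l2_of_tail_scaled: "l2 b"
    and l2_tail_norm_scaled: "l2_tail_norm N b = cmod c * l2_tail_norm N a"
proof -
  have b: "(\<lambda>j. (cmod (b (j + N)))\<^sup>2) = (\<lambda>j. (cmod c)\<^sup>2 * (cmod (a (j + N)))\<^sup>2)"
    by (simp add: assms(2) norm_mult power_mult_distrib)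
  have a: "summable (\<lambda>j. (cmod (a (j + N)))\<^sup>2)"
    using assms(1) by (simp add: l2_shift[of a N])
  show "l2 b"
    unfolding l2_shift[of b N] b using a by (rule summable_mult)
  show "l2_tail_norm N b = cmod c * l2_tail_norm N a"
    unfolding l2_tail_norm_def b by (simp add: suminf_mult[OF a] real_sqrt_mult)
qed

section \<open>Trading norm excess for interpolation error\<close>

context rkhs
begin

text \<open>
  The residual left by one approximate interpolant is itself approximated, and so on. The
  corrections are dominated by a geometric series with ratio \<open>d\<close>, so they sum to some \<open>f\<close> in the
  space; since \<open>f \<mapsto> f (lam n) * w n\<close> respects pointwise convergent sums and the residuals at
  each \<open>n \<ge> N\<close> tend to \<open>0\<close>, the limit interpolates exactly.
\<close>

lemma exact_from_approximate_interpolation: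
  assumes lam: "\<And>n. lam n \<in> S" and d: "0 \<le> d" "d < 1"
    and approx: "\<And>b. l2 b \<Longrightarrow> \<exists>G\<in>H. hnorm ip G \<le> l2_tail_norm N b \<and>
        l2 (\<lambda>n. b n - G (lam n) * w n) \<and>
        l2_tail_norm N (\<lambda>n. b n - G (lam n) * w n) \<le> d * l2_tail_norm N b"
    and a: "l2 a"
  shows "\<exists>f\<in>H. (\<forall>n\<ge>N. f (lam n) * w n = a n) \<and> hnorm ip f \<le> l2_tail_norm N a / (1 - d)"
proof -
  define good where "good b G \<longleftrightarrow> G \<in> H \<and> hnorm ip G \<le> l2_tail_norm N b \<and>
      l2 (\<lambda>n. b n - G (lam n) * w n) \<and>
      l2_tail_norm N (\<lambda>n. b n - G (lam n) * w n) \<le> d * l2_tail_norm N b" for b G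
  have "\<forall>b\<in>Collect l2. \<exists>G. good b G"
    unfolding good_def using approx by (simp add: Bex_def)
  then obtain F where good: "\<forall>b\<in>Collect l2. good b (F b)"
    by (blast dest: bchoice)
  have F: "F b \<in> H"
    and F_norm: "hnorm ip (F b) \<le> l2_tail_norm N b"
    and F_l2: "l2 (\<lambda>n. b n - F b (lam n) * w n)"
    and F_err: "l2_tail_norm N (\<lambda>n. b n - F b (lam n) * w n) \<le> d * l2_tail_norm N b"
    if "l2 b" for b
    using good that by (simp_all add: good_def)
  define A where "A = rec_nat a (\<lambda>_ b. (\<lambda>n. b n - F b (lam n) * w n))"
  have A_0: "A 0 = a" and A_Suc: "A (Suc k) = (\<lambda>n. A k n - F (A k) (lam n) * w n)" for k
    by (simp_all add: A_def)
  have A_l2: "l2 (A k)" for k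
    by (induction k) (simp_all add: A_0 A_Suc a F_l2)
  have A_norm: "l2_tail_norm N (A k) \<le> l2_tail_norm N a * d ^ k" for k
  proof (induction k)
    case 0
    then show ?case by (simp add: A_0)
  next
    case (Suc k)
    have "l2_tail_norm N (A (Suc k)) \<le> d * l2_tail_norm N (A k)"
      using F_err[OF A_l2[of k]] by (simp add: A_Suc)
    also have "\<dots> \<le> d * (l2_tail_norm N a * d ^ k)"
      using Suc d(1) by (rule mult_left_mono)
    finally show ?case by (simp add: mult_ac)
  qed
  have geometric: "(\<lambda>k. l2_tail_norm N a * d ^ k) sums (l2_tail_norm N a * (1 / (1 - d)))"
    using d by (intro sums_mult geometric_sums) simp
  have "hnorm ip (F (A k)) \<le> l2_tail_norm N a * d ^ k" for k
    using F_norm[OF A_l2] A_norm order_trans by blast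
  from absolutely_convergent_series[OF F[OF A_l2] this sums_summable[OF geometric]]
  obtain f where f: "f \<in> H" and f_norm: "hnorm ip f \<le> (\<Sum>k. l2_tail_norm N a * d ^ k)"
    and f_sums: "\<And>z. z \<in> S \<Longrightarrow> (\<lambda>k. F (A k) z) sums f z"
    by blast
  have "f (lam n) * w n = a n" if "n \<ge> N" for n
  proof -
    have "(\<lambda>k. l2_tail_norm N a * d ^ k) \<longlonglongrightarrow> 0"
      using geometric by (blast intro: summable_LIMSEQ_zero sums_summable)
    then have "(\<lambda>k. A k n) \<longlonglongrightarrow> 0"
      by (rule Lim_null_comparison[rotated])
        (intro always_eventually allI order_trans[OF norm_le_l2_tail_norm[OF A_l2 that] A_norm])
    \<comment> \<open>The corrections are the successive differences of the residuals, so they telescope.\<close>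
    then have "(\<lambda>k. A k n - A (Suc k) n) sums (A 0 n - 0)"
      by (rule telescope_sums')
    then have "(\<lambda>k. F (A k) (lam n) * w n) sums a n"
      by (simp add: A_0 A_Suc)
    moreover have "(\<lambda>k. F (A k) (lam n) * w n) sums (f (lam n) * w n)"
      using f_sums[OF lam] by (rule sums_mult2)
    ultimately show ?thesis
      using sums_unique2 by blast
  qed
  moreover have "hnorm ip f \<le> l2_tail_norm N a / (1 - d)"
    using f_norm sums_unique[OF geometric] by simp
  ultimately show ?thesis
    using f by blast
qed

lemma AIS_if_EIS:
  assumes "EIS H ip K lam"
  shows "AIS H ip K lam"
  unfolding AIS_def
proof (intro allI impI)
  fix \<epsilon> :: real assume \<epsilon>: "\<epsilon> > 0"
  let ?T = "\<lambda>f n. f (lam n) * K (lam n) (lam n) powr (- 1 / 2)"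
  obtain N where N: "\<And>a. l2 a \<Longrightarrow>
      \<exists>f\<in>H. (\<forall>n\<ge>N. ?T f n = a n) \<and> hnorm ip f \<le> (1 + \<epsilon>) * l2_tail_norm N a"
    using assms \<epsilon> unfolding EIS_def by blast
  have "\<exists>G\<in>H. hnorm ip G \<le> l2_tail_norm N a \<and> l2 (\<lambda>n. ?T G n - a n) \<and>
      l2_tail_norm N (\<lambda>n. ?T G n - a n) < \<epsilon> * l2_tail_norm N a"
    if a: "l2 a" and nz: "l2_tail_norm N a \<noteq> 0" for a
  proof -
    obtain f where f: "f \<in> H" and interp: "\<And>n. n \<ge> N \<Longrightarrow> ?T f n = a n"
      and f_norm: "hnorm ip f \<le> (1 + \<epsilon>) * l2_tail_norm N a"
      using N[OF a] by blast
    define q where "q = 1 / (1 + \<epsilon>)"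
    have q: "0 < q" "q < 1" "1 - q < \<epsilon>"
      using \<epsilon> by (simp_all add: q_def field_simps)
    let ?G = "\<lambda>z. of_real q * f z"
    have err: "?T ?G n - a n = of_real (q - 1) * a n" if "n \<ge> N" for n
      using interp[OF that] by (simp add: algebra_simps)
    have "hnorm ip ?G = q * hnorm ip f"
      using q by (simp add: hnorm_scale[OF f])
    also have "\<dots> \<le> l2_tail_norm N a"
      using f_norm \<epsilon> by (simp add: q_def field_simps)
    finally have "hnorm ip ?G \<le> l2_tail_norm N a" .
    moreover have "l2 (\<lambda>n. ?T ?G n - a n)"
      using a err by (rule l2_of_tail_scaled)
    moreover have "l2_tail_norm N (\<lambda>n. ?T ?G n - a n) = cmod (of_real (q - 1)) * l2_tail_norm N a"
      using a err by (rule l2_tail_norm_scaled)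
    then have "l2_tail_norm N (\<lambda>n. ?T ?G n - a n) = (1 - q) * l2_tail_norm N a"
      unfolding norm_of_real using q by simp
    moreover have "(1 - q) * l2_tail_norm N a < \<epsilon> * l2_tail_norm N a"
      using q(3) nz l2_tail_norm_nonneg[OF a, of N] by (intro mult_strict_right_mono) auto
    ultimately show ?thesis
      using scale_mem[OF f, of "of_real q"] by (intro bexI[of _ ?G]) simp_all
  qed
  then show "\<exists>N. \<forall>a. l2 a \<and> l2_tail_norm N a \<noteq> 0 \<longrightarrow>
      (\<exists>G\<in>H. hnorm ip G \<le> l2_tail_norm N a \<and> l2 (\<lambda>n. ?T G n - a n) \<and>
        l2_tail_norm N (\<lambda>n. ?T G n - a n) < \<epsilon> * l2_tail_norm N a)"
    by blast
qed

lemma EIS_if_AIS: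
  assumes lam: "\<And>n. lam n \<in> S" and "AIS H ip K lam"
  shows "EIS H ip K lam"
  unfolding EIS_def
proof (intro allI impI)
  fix \<epsilon> :: real assume \<epsilon>: "\<epsilon> > 0"
  let ?T = "\<lambda>f n. f (lam n) * K (lam n) (lam n) powr (- 1 / 2)"
  define d where "d = \<epsilon> / (1 + \<epsilon>)"
  have d: "0 < d" "d < 1" and sum_d: "1 / (1 - d) = 1 + \<epsilon>"
    using \<epsilon> by (simp_all add: d_def field_simps)
  obtain N where N: "\<And>a. l2 a \<Longrightarrow> l2_tail_norm N a \<noteq> 0 \<Longrightarrow>
      \<exists>G\<in>H. hnorm ip G \<le> l2_tail_norm N a \<and> l2 (\<lambda>n. ?T G n - a n) \<and>
        l2_tail_norm N (\<lambda>n. ?T G n - a n) < d * l2_tail_norm N a"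
    using \<open>AIS H ip K lam\<close> d(1) unfolding AIS_def by blast
  have approx: "\<exists>G\<in>H. hnorm ip G \<le> l2_tail_norm N b \<and> l2 (\<lambda>n. b n - ?T G n) \<and>
      l2_tail_norm N (\<lambda>n. b n - ?T G n) \<le> d * l2_tail_norm N b" if b: "l2 b" for b
  proof (cases "l2_tail_norm N b = 0")
    case True
    \<comment> \<open>The iteration may reach a zero residual, which needs no further correction.\<close>
    then show ?thesis
      using b by (intro bexI[of _ "\<lambda>_. 0"]) (simp_all add: hnorm_zero zero_mem)
  next
    case False
    from N[OF b False] show ?thesis
      unfolding l2_def l2_tail_norm_def by (auto simp: norm_minus_commute intro: less_imp_le)
  qed
  have "\<exists>f\<in>H. (\<forall>n\<ge>N. ?T f n = a n) \<and> hnorm ip f \<le> (1 + \<epsilon>) * l2_tail_norm N a"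
    if "l2 a" for a
    using exact_from_approximate_interpolation[OF lam less_imp_le[OF d(1)] d(2) approx that]
    by (simp add: mult.commute flip: sum_d)
  then show "\<exists>N. \<forall>a. l2 a \<longrightarrow>
      (\<exists>f\<in>H. (\<forall>n\<ge>N. ?T f n = a n) \<and> hnorm ip f \<le> (1 + \<epsilon>) * l2_tail_norm N a)"
    by blast
qed

end

theorem theorem3p4:
  fixes \<Omega> :: "(complex ^ 'n) set"
    and H :: "(complex ^ 'n \<Rightarrow> complex) set"
    and ip :: "(complex ^ 'n \<Rightarrow> complex) \<Rightarrow> (complex ^ 'n \<Rightarrow> complex) \<Rightarrow> complex"
    and K :: "complex ^ 'n \<Rightarrow> complex ^ 'n \<Rightarrow> complex"
    and lam :: "nat \<Rightarrow> complex ^ 'n"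
  assumes "open \<Omega>" and "connected \<Omega>" and "\<Omega> \<noteq> {}"
    and "rkhs \<Omega> H ip K"
    and "\<And>f. f \<in> H \<Longrightarrow> analytic_several \<Omega> f"
    and "\<And>n. lam n \<in> \<Omega>"
    and "\<And>n. K (lam n) (lam n) \<noteq> 0"
  shows "EIS H ip K lam \<longleftrightarrow> AIS H ip K lam"
  using rkhs.AIS_if_EIS[OF assms(4)] rkhs.EIS_if_AIS[where lam = lam, OF assms(4,6)] by blast

end
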